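(* Let $(X,d,E)$ and $(Y,\rho,F)$ be vector metric spaces and let $(f_n)$ be a sequence of vectorial continuous functions from $X$ to $Y$. If $(f_n)$ is uniformly $F$-convergent to a function $f:X\to Y$, then $f$ is vectorial continuous.
   Context: In a Riesz space $E$, $a_n\downarrow 0$ means $(a_n)$ is a decreasing sequence in $E$ with $\inf_n a_n=0$. A vector metric ($E$-metric) on a non-empty set $X$, with $E$ a Riesz space, is a map $d:X\times X\to E$ such that (vm1) $d(x,y)=0$ if and only if $x=y$; (vm2) $d(x,y)\le d(x,z)+d(y,z)$ for all $x,y,z\in X$. The triple $(X,d,E)$ is a vector metric space. A sequence $(x_n)$ in $X$ is $E$-convergent to $x\in X$, written $x_n\xrightarrow{d,E}x$, if there is a sequence $(a_n)$ in $E$ with $a_n\downarrow 0$ and $d(x_n,x)\le a_n$ for all $n$. A function $f:(X,d,E)\to(Y,\rho,F)$ is vectorial continuous if, for every $x\in X$, $x_n\xrightarrow{d,E}x$ implies $f(x_n)\xrightarrow{\rho,F}f(x)$. A sequence $(f_n)$ of functions from $X$ to $Y$ is uniformly $F$-convergent to $f:X\to Y$ if there is a sequence $(a_n)$ in $F$ with $a_n\downarrow 0$ and $\rho(f_n(x),f(x))\le a_n$ for all $x\in X$ and all $n\in\mathbb{N}$. *)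

theory Defs
  imports Complex_Main "HOL-Library.Lub_Glb" "HOL-Library.FuncSet"
begin

class riesz_space = ordered_real_vector + lattice

(* isGlb: 0 is an existing infimum of the range; the order need not be complete. *)
definition decreases_to_zero :: "(nat \<Rightarrow> 'e::riesz_space) \<Rightarrow> bool" where
  "decreases_to_zero a \<longleftrightarrow> decseq a \<and> isGlb UNIV (range a) 0"

(* Nonnegativity and symmetry of d are consequences of the last two assumptions. *)
locale vector_metric_space =
  fixes X :: "'a set" and d :: "'a \<Rightarrow> 'a \<Rightarrow> 'e::riesz_space"
  assumes nonempty: "X \<noteq> {}"
    and eq_zero_iff: "\<And>x y. x \<in> X \<Longrightarrow> y \<in> X \<Longrightarrow> d x y = 0 \<longleftrightarrow> x = y"
    and triangle: "\<And>x y z. x \<in> X \<Longrightarrow> y \<in> X \<Longrightarrow> z \<in> X \<Longrightarrow> d x y \<le> d x z + d y z"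

definition vector_converges ::
    "'a set \<Rightarrow> ('a \<Rightarrow> 'a \<Rightarrow> 'e::riesz_space) \<Rightarrow> (nat \<Rightarrow> 'a) \<Rightarrow> 'a \<Rightarrow> bool" where
  "vector_converges X d s x \<longleftrightarrow>
     range s \<subseteq> X \<and> x \<in> X \<and> (\<exists>a. decreases_to_zero a \<and> (\<forall>n. d (s n) x \<le> a n))"

definition vectorial_continuous ::
    "'a set \<Rightarrow> ('a \<Rightarrow> 'a \<Rightarrow> 'e::riesz_space) \<Rightarrow>
     'b set \<Rightarrow> ('b \<Rightarrow> 'b \<Rightarrow> 'f::riesz_space) \<Rightarrow> ('a \<Rightarrow> 'b) \<Rightarrow> bool" where
  "vectorial_continuous X d Y \<rho> f \<longleftrightarrow>
     f \<in> X \<rightarrow> Y \<and>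
     (\<forall>x\<in>X. \<forall>s. vector_converges X d s x \<longrightarrow> vector_converges Y \<rho> (\<lambda>n. f (s n)) (f x))"

definition uniformly_vector_converges ::
    "'a set \<Rightarrow> ('b \<Rightarrow> 'b \<Rightarrow> 'f::riesz_space) \<Rightarrow> (nat \<Rightarrow> 'a \<Rightarrow> 'b) \<Rightarrow> ('a \<Rightarrow> 'b) \<Rightarrow> bool" where
  "uniformly_vector_converges X \<rho> fs f \<longleftrightarrow>
     (\<exists>a. decreases_to_zero a \<and> (\<forall>x\<in>X. \<forall>n. \<rho> (fs n x) (f x) \<le> a n))"

end

(* The bound 2 a k + b k n (a for uniform convergence, b k for continuity of the k-th function) holds
   for every k. Instead of choosing k depending on n, take the infimum over k \<le> n. It involves finitely
   many terms, so it exists in any Riesz space, and no completeness or Archimedean property is used. *)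
theory Submission imports Defs begin

lemma decreases_to_zero_iff:
  "decreases_to_zero a \<longleftrightarrow> decseq a \<and> (\<forall>n. 0 \<le> a n) \<and> (\<forall>z. (\<forall>n. z \<le> a n) \<longrightarrow> z \<le> 0)"
  unfolding decreases_to_zero_def isGlb_def greatestP_def isLb_def setge_def setle_def
  by auto

text \<open>The two indices can be decoupled: comparing at \<open>max m n\<close> shows that a lower
  bound \<open>z\<close> of the sums satisfies \<open>z \<le> a m + b n\<close> for independent
  \<open>m\<close> and \<open>n\<close>. The infima over \<open>n\<close> and then over
  \<open>m\<close> are taken one at a time.\<close>

lemma decreases_to_zero_add:
  assumes a: "decreases_to_zero a" and b: "decreases_to_zero b"
  shows "decreases_to_zero (\<lambda>n. a n + b n)"
  unfolding decreases_to_zero_iff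
proof (intro conjI allI impI)
  have dec: "decseq a" "decseq b" and nonneg: "\<And>n. 0 \<le> a n" "\<And>n. 0 \<le> b n"
    using a b by (auto simp: decreases_to_zero_iff)
  show "decseq (\<lambda>n. a n + b n)"
    using dec by (auto simp: decseq_def intro: add_mono)
  show "0 \<le> a n + b n" for n
    using nonneg by simp
  show "z \<le> 0" if z: "\<forall>n. z \<le> a n + b n" for z
  proof -
    have "z - a m \<le> b n" for m n
    proof -
      have "z \<le> a (max m n) + b (max m n)"
        using z by blast
      also have "\<dots> \<le> a m + b n"
        using dec by (intro add_mono) (auto simp: decseq_def)
      finally show ?thesis
        by (simp add: diff_le_eq add.commute)
    qed
    then have "z - a m \<le> 0" for m
      using b unfolding decreases_to_zero_iff by blast
    then have "z \<le> a m" for m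
      by simp
    then show ?thesis
      using a by (auto simp: decreases_to_zero_iff)
  qed
qed

text \<open>A lower bound of the finite infima lies below every \<open>a k + b k n\<close>, so
  letting \<open>n\<close> vary for fixed \<open>k\<close>, and only then \<open>k\<close>, forces
  it below 0. The set \<open>{..n}\<close> is never empty, so \<open>Inf_fin\<close> is a genuine
  infimum.\<close>

lemma decreases_to_zero_diagonal_Inf_fin:
  fixes b :: "nat \<Rightarrow> nat \<Rightarrow> 'e::riesz_space"
  assumes a: "decreases_to_zero a" and b: "\<And>k. decreases_to_zero (b k)"
  shows "decreases_to_zero (\<lambda>n. Inf_fin ((\<lambda>k. a k + b k n) ` {..n}))" (is "decreases_to_zero ?c")
  unfolding decreases_to_zero_iff
proof (intro conjI allI impI)
  have dec: "b k n \<le> b k m" if "m \<le> n" for k m n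
    using b[of k] that by (auto simp: decreases_to_zero_iff decseq_def)
  have nonneg: "0 \<le> a k" "0 \<le> b k n" for k n
    using a b[of k] by (auto simp: decreases_to_zero_iff)
  have c_le: "?c n \<le> a k + b k n" if "k \<le> n" for k n
    using that by (intro Inf_fin.coboundedI) auto
  show "decseq ?c"
    unfolding decseq_def
  proof (intro allI impI)
    fix m n :: nat
    assume "m \<le> n"
    \<comment> \<open>Passing from \<open>m\<close> to \<open>n\<close> keeps all indices
      \<open>k \<le> m\<close> and lowers each of their terms.\<close>
    have "?c n \<le> a k + b k m" if "k \<le> m" for k
      using c_le[of k n] dec[OF \<open>m \<le> n\<close>, of k] that \<open>m \<le> n\<close>
      by (meson add_left_mono order_trans)
    then show "?c n \<le> ?c m"
      by (intro Inf_fin.boundedI) auto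
  qed
  show "0 \<le> ?c n" for n
    using nonneg by (intro Inf_fin.boundedI) auto
  show "z \<le> 0" if z: "\<forall>n. z \<le> ?c n" for z
  proof -
    have "z - a k \<le> b k n" for k n
    proof -
      \<comment> \<open>The index \<open>max k n\<close> is at least \<open>k\<close>, so the
        \<open>k\<close>-th term enters the infimum, and at least \<open>n\<close>, so
        \<open>b k\<close> there is at most \<open>b k n\<close>.\<close>
      have "z \<le> a k + b k (max k n)"
        using z c_le[of k "max k n"] by (meson max.cobounded1 order_trans)
      also have "\<dots> \<le> a k + b k n"
        using dec by simp
      finally show ?thesis
        by (simp add: diff_le_eq add.commute)
    qed
    then have "z - a k \<le> 0" for k
      using b[of k] unfolding decreases_to_zero_iff by blast
    then have "z \<le> a k" for k
      by simp
    then show ?thesis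
      using a by (auto simp: decreases_to_zero_iff)
  qed
qed

text \<open>Taking the third point of the triangle inequality equal to the first leaves
  \<open>d x y \<le> d y x\<close>; exchanging the points gives the converse.\<close>

lemma (in vector_metric_space) commute:
  assumes "x \<in> X" "y \<in> X"
  shows "d x y = d y x"
  using triangle[of x y x] triangle[of y x y] eq_zero_iff[of x x] eq_zero_iff[of y y] assms
  by (simp add: order_antisym)

theorem theorem8:
  fixes X :: "'a set" and d :: "'a \<Rightarrow> 'a \<Rightarrow> 'e::riesz_space"
    and Y :: "'b set" and \<rho> :: "'b \<Rightarrow> 'b \<Rightarrow> 'f::riesz_space"
    and fs :: "nat \<Rightarrow> 'a \<Rightarrow> 'b" and f :: "'a \<Rightarrow> 'b"
  assumes "vector_metric_space X d"
    and "vector_metric_space Y \<rho>"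
    and "\<And>n. vectorial_continuous X d Y \<rho> (fs n)"
    and "f \<in> X \<rightarrow> Y"
    and "uniformly_vector_converges X \<rho> fs f"
  shows "vectorial_continuous X d Y \<rho> f"
  unfolding vectorial_continuous_def
proof (intro conjI ballI allI impI)
  interpret Y: vector_metric_space Y \<rho> by fact
  show "f \<in> X \<rightarrow> Y" by fact
  fix x s
  assume "x \<in> X" and s: "vector_converges X d s x"
  have sX: "s n \<in> X" for n
    using s by (auto simp: vector_converges_def)
  have fY: "f y \<in> Y" if "y \<in> X" for y
    using assms(4) that by blast
  have fsY: "fs k y \<in> Y" if "y \<in> X" for k y
    using assms(3)[of k] that by (auto simp: vectorial_continuous_def)
  obtain a where a: "decreases_to_zero a"
    and fs_f: "\<And>k y. y \<in> X \<Longrightarrow> \<rho> (fs k y) (f y) \<le> a k"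
    using assms(5) by (auto simp: uniformly_vector_converges_def)
  have "\<exists>b. decreases_to_zero b \<and> (\<forall>n. \<rho> (fs k (s n)) (fs k x) \<le> b n)" for k
    using assms(3)[of k] \<open>x \<in> X\<close> s by (auto simp: vectorial_continuous_def vector_converges_def)
  then obtain b where b: "\<And>k. decreases_to_zero (b k)"
    and fs_s: "\<And>k n. \<rho> (fs k (s n)) (fs k x) \<le> b k n"
    by metis
  \<comment> \<open>The path runs from \<open>f (s n)\<close> through \<open>fs k (s n)\<close> and
    \<open>fs k x\<close> to \<open>f x\<close>. Its two outer legs cost \<open>a k\<close> each by
    uniform convergence, the middle one \<open>b k n\<close> by continuity of
    \<open>fs k\<close>.\<close>
  have bound: "\<rho> (f (s n)) (f x) \<le> a k + a k + b k n" for k n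
  proof -
    have "\<rho> (f (s n)) (f x) \<le> \<rho> (f (s n)) (fs k (s n)) + \<rho> (f x) (fs k (s n))"
      using sX \<open>x \<in> X\<close> by (intro Y.triangle fY fsY)
    also have "\<dots> \<le> \<rho> (f (s n)) (fs k (s n)) + (\<rho> (f x) (fs k x) + \<rho> (fs k (s n)) (fs k x))"
      using sX \<open>x \<in> X\<close> by (intro add_left_mono Y.triangle fY fsY)
    also have "\<dots> = \<rho> (fs k (s n)) (f (s n)) + (\<rho> (fs k x) (f x) + \<rho> (fs k (s n)) (fs k x))"
      using sX \<open>x \<in> X\<close> by (simp add: Y.commute fY fsY)
    also have "\<dots> \<le> a k + (a k + b k n)"
      using sX \<open>x \<in> X\<close> by (intro add_mono fs_f fs_s)
    finally show ?thesis
      by (simp add: add.assoc)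
  qed
  have "\<rho> (f (s n)) (f x) \<le> Inf_fin ((\<lambda>k. a k + a k + b k n) ` {..n})" for n
    using bound by (intro Inf_fin.boundedI) auto
  \<comment> \<open>The doubled sequence \<open>a k + a k\<close> takes the role of \<open>a\<close>
    in the diagonal lemma.\<close>
  moreover have "decreases_to_zero (\<lambda>n. Inf_fin ((\<lambda>k. a k + a k + b k n) ` {..n}))"
    by (intro decreases_to_zero_diagonal_Inf_fin decreases_to_zero_add a b)
  ultimately show "vector_converges Y \<rho> (\<lambda>n. f (s n)) (f x)"
    using sX \<open>x \<in> X\<close> fY by (auto simp: vector_converges_def)
qed

end
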